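(* Let $Z$ be an arbitrary operator space, let $X\subset Y$ be separable operator spaces, and let $T:Y\to\ell^\infty(Z)$ be a completely bounded linear operator, with $T(y)=(T_n(y))_{n\ge1}$ for all $y\in Y$, such that (i) $T(X)\subset c_0(Z)$, and (ii) $(T_n)$ is relatively compact in the strong operator topology. Then there exists a completely bounded operator $\tilde T:Y\to c_0(Z)$ extending $T|_X$ with $\|\tilde T\|_{cb}\le2\|T\|_{cb}$.
   Context: Operator spaces are closed linear subspaces of $\mathcal L(H)$, $H$ a Hilbert space, with inherited matrix norms; $X\subset Y$ means $X$ is a closed linear subspace of $Y$ with the inherited operator space structure. $\ell^\infty(Z)$ is the space of all bounded sequences in $Z$ with the sup norm and matrix norms given by suprema over coordinates, and $c_0(Z)$ is its subspace of sequences $(z_j)$ with $\|z_j\|\to0$. The operators $T_n:Y\to Z$ are the coordinates of $T$; the strong operator topology (SOT) on $\mathcal L(Y,Z)$, the bounded linear operators from $Y$ to $Z$, is the topology of pointwise norm convergence on $Y$. Relatively compact means having compact closure in $\mathcal L(Y,Z)$ for this topology. *)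

theory Defs
  imports "HOL-Analysis.Analysis"
begin

section \<open>Complex normed spaces and Hilbert spaces\<close>

class complex_normed_vector = real_normed_vector +
  fixes scaleC :: "complex \<Rightarrow> 'a \<Rightarrow> 'a"  (infixr \<open>*\<^sub>C\<close> 75)
  assumes scaleC_add_right: "c *\<^sub>C (x + y) = c *\<^sub>C x + c *\<^sub>C y"
    and scaleC_add_left: "(c + d) *\<^sub>C x = c *\<^sub>C x + d *\<^sub>C x"
    and scaleC_scaleC: "c *\<^sub>C d *\<^sub>C x = (c * d) *\<^sub>C x"
    and scaleC_of_real: "complex_of_real r *\<^sub>C x = r *\<^sub>R x"
    and norm_scaleC: "norm (c *\<^sub>C x) = cmod c * norm x"

lemma bounded_linear_scaleC: "bounded_linear (\<lambda>x::'a::complex_normed_vector. c *\<^sub>C x)"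
proof (rule bounded_linear_intro[where K = "cmod c"])
  fix r :: real and x :: 'a
  show "c *\<^sub>C r *\<^sub>R x = r *\<^sub>R c *\<^sub>C x"
    by (metis mult.commute scaleC_of_real scaleC_scaleC)
qed (simp_all add: scaleC_add_right norm_scaleC mult.commute)

text \<open>The inner product is linear in the first argument; positive definiteness is part of
  \<open>cinner_self\<close>.\<close>

class complex_hilbert = complex_normed_vector + complete_space +
  fixes cinner :: "'a \<Rightarrow> 'a \<Rightarrow> complex"
  assumes cinner_add_left: "cinner (x + y) z = cinner x z + cinner y z"
    and cinner_scaleC_left: "cinner (c *\<^sub>C x) y = c * cinner x y"
    and cinner_commute: "cinner x y = cnj (cinner y x)"
    and cinner_self: "cinner x x = complex_of_real ((norm x)\<^sup>2)"

instantiation complex :: complex_hilbert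
begin

definition scaleC_complex :: "complex \<Rightarrow> complex \<Rightarrow> complex"
  where "scaleC_complex c x = c * x"

definition cinner_complex :: "complex \<Rightarrow> complex \<Rightarrow> complex"
  where "cinner_complex x y = x * cnj y"

instance
proof
  fix c x y z :: complex
  show "cinner (x + y) z = cinner x z + cinner y z" "cinner (c *\<^sub>C x) y = c * cinner x y"
    by (simp_all add: scaleC_complex_def cinner_complex_def distrib_right)
  show "cinner x y = cnj (cinner y x)"
    by (simp add: cinner_complex_def)
  show "cinner x x = complex_of_real ((norm x)\<^sup>2)"
    unfolding cinner_complex_def by (rule complex_norm_square[symmetric])
qed (simp_all add: scaleC_complex_def distrib_left distrib_right norm_mult scaleR_conv_of_real)

end

instantiation blinfun :: (real_normed_vector, complex_normed_vector) complex_normed_vector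
begin

definition scaleC_blinfun :: "complex \<Rightarrow> ('a \<Rightarrow>\<^sub>L 'b) \<Rightarrow> ('a \<Rightarrow>\<^sub>L 'b)"
  where "scaleC_blinfun c A = Blinfun (\<lambda>x. c *\<^sub>C blinfun_apply A x)"

lemma blinfun_apply_scaleC: "blinfun_apply (c *\<^sub>C A) x = c *\<^sub>C blinfun_apply A x"
  for A :: "'a \<Rightarrow>\<^sub>L 'b"
  unfolding scaleC_blinfun_def
  by (subst bounded_linear_Blinfun_apply)
    (auto intro: bounded_linear_compose[OF bounded_linear_scaleC] blinfun.bounded_linear_right)

instance
proof
  fix c d :: complex and r :: real and A B :: "'a \<Rightarrow>\<^sub>L 'b"
  show "c *\<^sub>C (A + B) = c *\<^sub>C A + c *\<^sub>C B" "(c + d) *\<^sub>C A = c *\<^sub>C A + d *\<^sub>C A"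
    and assoc: "c *\<^sub>C d *\<^sub>C A = (c * d) *\<^sub>C A"
    and real: "complex_of_real r *\<^sub>C A = r *\<^sub>R A"
    for c d r A
    by (auto intro!: blinfun_eqI simp: blinfun_apply_scaleC blinfun.bilinear_simps
        scaleC_add_right scaleC_add_left scaleC_scaleC scaleC_of_real)
  have le: "norm (c *\<^sub>C A) \<le> cmod c * norm A" for c and A :: "'a \<Rightarrow>\<^sub>L 'b"
    by (rule norm_blinfun_bound)
      (auto simp: blinfun_apply_scaleC norm_scaleC mult.assoc intro!: mult_left_mono norm_blinfun)
  show "norm (c *\<^sub>C A) = cmod c * norm A"
  proof (cases "c = 0")
    case True
    then show ?thesis using le[of c A] by simp
  next
    case False
    have "A = inverse c *\<^sub>C c *\<^sub>C A"
      using False real[of 1 A] by (simp add: assoc)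
    then have "norm A \<le> cmod (inverse c) * norm (c *\<^sub>C A)"
      using le by metis
    then have "cmod c * norm A \<le> norm (c *\<^sub>C A)"
      using False by (simp add: norm_divide field_simps)
    then show ?thesis using le[of c A] by simp
  qed
qed

end

instantiation bcontfun :: (topological_space, complex_normed_vector) complex_normed_vector
begin

definition scaleC_bcontfun :: "complex \<Rightarrow> ('a \<Rightarrow>\<^sub>C 'b) \<Rightarrow> ('a \<Rightarrow>\<^sub>C 'b)"
  where "scaleC_bcontfun c f = Bcontfun (\<lambda>x. c *\<^sub>C apply_bcontfun f x)"

lemma apply_bcontfun_scaleC: "apply_bcontfun (c *\<^sub>C f) x = c *\<^sub>C apply_bcontfun f x"
  for f :: "'a \<Rightarrow>\<^sub>C 'b"
proof -
  have "continuous_on UNIV (\<lambda>x. c *\<^sub>C apply_bcontfun f x)"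
    by (intro bounded_linear.continuous_on[OF bounded_linear_scaleC] continuous_on_apply_bcontfun)
  moreover have "norm (c *\<^sub>C apply_bcontfun f x) \<le> cmod c * norm f" for x
    by (auto simp: norm_scaleC intro!: mult_left_mono norm_bounded)
  ultimately have "(\<lambda>x. c *\<^sub>C apply_bcontfun f x) \<in> bcontfun"
    by (rule bcontfun_normI)
  then show ?thesis
    by (simp add: scaleC_bcontfun_def Bcontfun_inverse)
qed

instance
proof
  fix c d :: complex and r :: real and f g :: "'a \<Rightarrow>\<^sub>C 'b"
  show "c *\<^sub>C (f + g) = c *\<^sub>C f + c *\<^sub>C g" "(c + d) *\<^sub>C f = c *\<^sub>C f + d *\<^sub>C f"
    and assoc: "c *\<^sub>C d *\<^sub>C f = (c * d) *\<^sub>C f"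
    and real: "complex_of_real r *\<^sub>C f = r *\<^sub>R f"
    for c d r f
    by (auto intro!: bcontfun_eqI simp: apply_bcontfun_scaleC
        scaleC_add_right scaleC_add_left scaleC_scaleC scaleC_of_real)
  have le: "norm (c *\<^sub>C f) \<le> cmod c * norm f" for c and f :: "'a \<Rightarrow>\<^sub>C 'b"
    by (rule norm_bound)
      (auto simp: apply_bcontfun_scaleC norm_scaleC intro!: mult_left_mono norm_bounded)
  show "norm (c *\<^sub>C f) = cmod c * norm f"
  proof (cases "c = 0")
    case True
    then show ?thesis using le[of c f] by simp
  next
    case False
    have "f = inverse c *\<^sub>C c *\<^sub>C f"
      using False real[of 1 f] by (simp add: assoc)
    then have "norm f \<le> cmod (inverse c) * norm (c *\<^sub>C f)"
      using le by metis
    then have "cmod c * norm f \<le> norm (c *\<^sub>C f)"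
      using False by (simp add: norm_divide field_simps)
    then show ?thesis using le[of c f] by simp
  qed
qed

end

definition csubspace :: "'a::complex_normed_vector set \<Rightarrow> bool"
  where "csubspace S \<longleftrightarrow>
    0 \<in> S \<and> (\<forall>x\<in>S. \<forall>y\<in>S. x + y \<in> S) \<and> (\<forall>c. \<forall>x\<in>S. c *\<^sub>C x \<in> S)"

definition clinear_on ::
    "'a::complex_normed_vector set \<Rightarrow> ('a \<Rightarrow> 'b::complex_normed_vector) \<Rightarrow> bool"
  where "clinear_on S f \<longleftrightarrow>
    (\<forall>x\<in>S. \<forall>y\<in>S. f (x + y) = f x + f y) \<and> (\<forall>c. \<forall>x\<in>S. f (c *\<^sub>C x) = c *\<^sub>C f x)"


section \<open>Operator spaces\<close>

text \<open>The library type \<open>'h \<Rightarrow>\<^sub>L 'h\<close> consists of the real-linear bounded operators, so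
  complex linearity of the elements is required separately. The norm of \<open>'h \<Rightarrow>\<^sub>L 'h\<close> is
  the operator norm.\<close>

definition operator_space :: "('h::complex_hilbert \<Rightarrow>\<^sub>L 'h) set \<Rightarrow> bool"
  where "operator_space E \<longleftrightarrow>
    closed E \<and> csubspace E \<and> (\<forall>A\<in>E. clinear_on UNIV (blinfun_apply A))"

text \<open>An \<open>n \<times> n\<close> matrix is a function of two indices of which only the values at
  indices below \<open>n\<close> matter. The norm of a matrix of operators on \<open>H\<close> is its norm as an
  operator on the Hilbert space direct sum of \<open>n\<close> copies of \<open>H\<close>.\<close>

type_synonym 'a matrix_norm = "nat \<Rightarrow> (nat \<Rightarrow> nat \<Rightarrow> 'a) \<Rightarrow> real"

definition op_matrix_norm :: "('h::complex_hilbert \<Rightarrow>\<^sub>L 'h) matrix_norm"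
  where "op_matrix_norm n a =
    Sup {L2_set (\<lambda>i. norm (\<Sum>j<n. blinfun_apply (a i j) (\<xi> j))) {..<n} | \<xi> :: nat \<Rightarrow> 'h.
      L2_set (\<lambda>j. norm (\<xi> j)) {..<n} \<le> 1}"

lemma op_matrix_norm_bdd_above:
  "bdd_above {L2_set (\<lambda>i. norm (\<Sum>j<n. blinfun_apply (a i j) (\<xi> j))) {..<n} | \<xi>.
      L2_set (\<lambda>j. norm (\<xi> j)) {..<n} \<le> 1}"
  and op_matrix_norm_le: "op_matrix_norm n a \<le> (\<Sum>i<n. \<Sum>j<n. norm (a i j))"
proof -
  have *: "L2_set (\<lambda>i. norm (\<Sum>j<n. blinfun_apply (a i j) (\<xi> j))) {..<n}
      \<le> (\<Sum>i<n. \<Sum>j<n. norm (a i j))"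
    if \<xi>: "L2_set (\<lambda>j. norm (\<xi> j)) {..<n} \<le> 1" for \<xi>
  proof -
    have "norm (\<xi> j) \<le> 1" if "j < n" for j
      using member_le_L2_set[of "{..<n}" j "\<lambda>j. norm (\<xi> j)"] that \<xi> by simp
    then have "norm (blinfun_apply (a i j) (\<xi> j)) \<le> norm (a i j)" if "j < n" for i j
      using that norm_blinfun[of "a i j" "\<xi> j"] mult_left_le[of "norm (\<xi> j)" "norm (a i j)"]
      by force
    then have "norm (\<Sum>j<n. blinfun_apply (a i j) (\<xi> j)) \<le> (\<Sum>j<n. norm (a i j))" for i
      by (intro order_trans[OF norm_sum] sum_mono) auto
    then show ?thesis
      by (intro order_trans[OF L2_set_le_sum] sum_mono) auto
  qed
  then show "bdd_above {L2_set (\<lambda>i. norm (\<Sum>j<n. blinfun_apply (a i j) (\<xi> j))) {..<n} | \<xi>.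
      L2_set (\<lambda>j. norm (\<xi> j)) {..<n} \<le> 1}"
    by (intro bdd_aboveI) auto
  have "L2_set (\<lambda>j. norm (0::'a)) {..<n} \<le> 1"
    by (simp add: L2_set_def)
  then show "op_matrix_norm n a \<le> (\<Sum>i<n. \<Sum>j<n. norm (a i j))"
    unfolding op_matrix_norm_def using * by (intro cSup_least) (auto intro!: exI[of _ "\<lambda>_. 0"])
qed


section \<open>Spaces of sequences\<close>

text \<open>As \<open>nat\<close> is discrete, \<open>nat \<Rightarrow>\<^sub>C 'a\<close> is the space of all bounded sequences in
  \<open>'a\<close>, with the sup norm.\<close>

definition linfty :: "'a::complex_normed_vector set \<Rightarrow> (nat \<Rightarrow>\<^sub>C 'a) set"
  where "linfty E = {z. \<forall>k. apply_bcontfun z k \<in> E}"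

definition c0 :: "'a::complex_normed_vector set \<Rightarrow> (nat \<Rightarrow>\<^sub>C 'a) set"
  where "c0 E = {z \<in> linfty E. (\<lambda>k. norm (apply_bcontfun z k)) \<longlonglongrightarrow> 0}"

definition seq_matrix_norm :: "(nat \<Rightarrow>\<^sub>C ('h::complex_hilbert \<Rightarrow>\<^sub>L 'h)) matrix_norm"
  where "seq_matrix_norm n z = (SUP k. op_matrix_norm n (\<lambda>i j. apply_bcontfun (z i j) k))"

lemma seq_matrix_norm_bdd_above:
  "bdd_above (range (\<lambda>k. op_matrix_norm n (\<lambda>i j. apply_bcontfun (z i j) k)))"
  by (intro bdd_aboveI2[where M = "\<Sum>i<n. \<Sum>j<n. norm (z i j)"] order_trans[OF op_matrix_norm_le]
      sum_mono norm_bounded)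


section \<open>Completely bounded maps\<close>

text \<open>\<open>amp_norm N M E n f\<close> is the norm of the amplification \<open>(a\<^sub>i\<^sub>j) \<mapsto> (f a\<^sub>i\<^sub>j)\<close> of a
  map \<open>f\<close> on \<open>E\<close> to \<open>n \<times> n\<close> matrices, where \<open>N\<close> and \<open>M\<close> are the matrix
  norms of the domain and of the codomain.\<close>

definition amp_norm ::
    "'a matrix_norm \<Rightarrow> 'b matrix_norm \<Rightarrow> 'a set \<Rightarrow> nat \<Rightarrow> ('a \<Rightarrow> 'b) \<Rightarrow> ennreal"
  where "amp_norm N M E n f =
    (SUP a \<in> {a. (\<forall>i<n. \<forall>j<n. a i j \<in> E) \<and> N n a \<le> 1}. ennreal (M n (\<lambda>i j. f (a i j))))"

definition cb_norm ::
    "'a matrix_norm \<Rightarrow> 'b matrix_norm \<Rightarrow> 'a set \<Rightarrow> ('a \<Rightarrow> 'b) \<Rightarrow> ennreal"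
  where "cb_norm N M E f = (SUP n \<in> {1..}. amp_norm N M E n f)"

definition completely_bounded ::
    "'a::complex_normed_vector matrix_norm \<Rightarrow> 'b::complex_normed_vector matrix_norm \<Rightarrow>
      'a set \<Rightarrow> 'b set \<Rightarrow> ('a \<Rightarrow> 'b) \<Rightarrow> bool"
  where "completely_bounded N M E F f \<longleftrightarrow>
    f ` E \<subseteq> F \<and> clinear_on E f \<and> cb_norm N M E f < \<infinity>"


section \<open>The strong operator topology\<close>

text \<open>The elements of \<open>bounded_ops E F\<close> are functions on \<open>E\<close>, encoded as total
  functions that are \<open>undefined\<close> outside \<open>E\<close>.\<close>

definition bounded_ops ::
    "'a::complex_normed_vector set \<Rightarrow> 'b::complex_normed_vector set \<Rightarrow> ('a \<Rightarrow> 'b) set"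
  where "bounded_ops E F =
    {f \<in> E \<rightarrow>\<^sub>E F. clinear_on E f \<and> (\<exists>K. \<forall>x\<in>E. norm (f x) \<le> K * norm x)}"

definition sot ::
    "'a::complex_normed_vector set \<Rightarrow> 'b::complex_normed_vector set \<Rightarrow> ('a \<Rightarrow> 'b) topology"
  where "sot E F = subtopology (product_topology (\<lambda>_. top_of_set F) E) (bounded_ops E F)"

definition relatively_compactin :: "'a topology \<Rightarrow> 'a set \<Rightarrow> bool"
  where "relatively_compactin X S \<longleftrightarrow> S \<subseteq> topspace X \<and> compactin X (X closure_of S)"

end

theory Submission
  imports Defs
begin

text \<open>The idea is to subtract from each coordinate \<open>T\<^sub>n\<close> a nearby cluster point of the sequence
  \<open>(T\<^sub>n)\<close>. By (i), \<open>T\<^sub>n x\<close> tends to \<open>0\<close> for every \<open>x \<in> X\<close>, so every cluster point \<open>S\<close> of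
  \<open>(T\<^sub>n)\<close> in the strong operator topology vanishes on \<open>X\<close>; and \<open>\<parallel>S\<parallel>\<^sub>c\<^sub>b \<le> \<parallel>T\<parallel>\<^sub>c\<^sub>b\<close>, because the
  matrix norms are continuous under entrywise convergence. If \<open>S\<^sub>n\<close> are such operators with
  \<open>T\<^sub>n y - S\<^sub>n y \<longlonglongrightarrow> 0\<close> for every \<open>y \<in> Y\<close>, then \<open>y \<mapsto> (T\<^sub>n y - S\<^sub>n y)\<^sub>n\<close> maps into \<open>c\<^sub>0(Z)\<close>, agrees
  with \<open>T\<close> on \<open>X\<close>, and has completely bounded norm at most \<open>\<parallel>T\<parallel>\<^sub>c\<^sub>b + \<parallel>T\<parallel>\<^sub>c\<^sub>b\<close>.

  Relative compactness provides the \<open>S\<^sub>n\<close>. Given finitely many points of \<open>Y\<close> and \<open>\<epsilon> > 0\<close>, all but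
  finitely many \<open>T\<^sub>n\<close> are \<open>\<epsilon>\<close>-close to some cluster point at these points: otherwise the
  exceptional \<open>T\<^sub>n\<close> would themselves accumulate somewhere (\<open>compactin_infinite_cluster_point\<close>). Applied
  to longer and longer initial segments of a dense sequence in \<open>Y\<close>, this allows a diagonal choice
  of \<open>S\<^sub>n\<close> (\<open>diagonal_selection\<close>) with convergence on the dense sequence, hence on \<open>Y\<close> by uniform
  boundedness (\<open>tendsto_zero_on_closure\<close>).\<close>


section \<open>Matrix norms\<close>

lemma L2_set_le_op_matrix_norm:
  assumes "L2_set (\<lambda>j. norm (\<xi> j)) {..<n} \<le> 1"
  shows "L2_set (\<lambda>i. norm (\<Sum>j<n. blinfun_apply (a i j) (\<xi> j))) {..<n} \<le> op_matrix_norm n a"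
  unfolding op_matrix_norm_def
  by (rule cSup_upper[OF _ op_matrix_norm_bdd_above]) (use assms in blast)

lemma op_matrix_norm_leI:
  assumes "\<And>\<xi>. L2_set (\<lambda>j. norm (\<xi> j)) {..<n} \<le> 1 \<Longrightarrow>
    L2_set (\<lambda>i. norm (\<Sum>j<n. blinfun_apply (a i j) (\<xi> j))) {..<n} \<le> c"
  shows "op_matrix_norm n a \<le> c"
proof -
  have "L2_set (\<lambda>j. norm (0::'a)) {..<n} \<le> 1"
    by (simp add: L2_set_def)
  then show ?thesis
    unfolding op_matrix_norm_def
    by (intro cSup_least) (use assms in \<open>auto intro!: exI[of _ "\<lambda>_. 0"]\<close>)
qed

lemma op_matrix_norm_triangle:
  "op_matrix_norm n (\<lambda>i j. a i j + b i j) \<le> op_matrix_norm n a + op_matrix_norm n b"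
proof (rule op_matrix_norm_leI)
  fix \<xi> :: "nat \<Rightarrow> 'a"
  assume \<xi>: "L2_set (\<lambda>j. norm (\<xi> j)) {..<n} \<le> 1"
  have "L2_set (\<lambda>i. norm (\<Sum>j<n. blinfun_apply (a i j + b i j) (\<xi> j))) {..<n}
      \<le> L2_set (\<lambda>i. norm (\<Sum>j<n. blinfun_apply (a i j) (\<xi> j)) +
          norm (\<Sum>j<n. blinfun_apply (b i j) (\<xi> j))) {..<n}"
    by (intro L2_set_mono) (auto simp: blinfun.add_left sum.distrib norm_triangle_ineq)
  also have "\<dots> \<le> L2_set (\<lambda>i. norm (\<Sum>j<n. blinfun_apply (a i j) (\<xi> j))) {..<n}
      + L2_set (\<lambda>i. norm (\<Sum>j<n. blinfun_apply (b i j) (\<xi> j))) {..<n}"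
    by (rule L2_set_triangle_ineq)
  also have "\<dots> \<le> op_matrix_norm n a + op_matrix_norm n b"
    by (intro add_mono L2_set_le_op_matrix_norm \<xi>)
  finally show "L2_set (\<lambda>i. norm (\<Sum>j<n. blinfun_apply (a i j + b i j) (\<xi> j))) {..<n}
      \<le> op_matrix_norm n a + op_matrix_norm n b" .
qed

lemma op_matrix_norm_uminus: "op_matrix_norm n (\<lambda>i j. - a i j) = op_matrix_norm n a"
  unfolding op_matrix_norm_def by (simp add: blinfun.minus_left sum_negf)

lemma op_matrix_norm_triangle_diff:
  "op_matrix_norm n (\<lambda>i j. a i j - b i j) \<le> op_matrix_norm n a + op_matrix_norm n b"
  using op_matrix_norm_triangle[of n a "\<lambda>i j. - b i j"] by (simp add: op_matrix_norm_uminus)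

lemma op_matrix_norm_1: "op_matrix_norm 1 a = norm (a 0 0)"
proof (rule antisym)
  show "op_matrix_norm 1 a \<le> norm (a 0 0)"
    using op_matrix_norm_le[of 1 a] by simp
  have unit: "norm (blinfun_apply (a 0 0) u) \<le> op_matrix_norm 1 a" if "norm u \<le> 1" for u
    using L2_set_le_op_matrix_norm[of "\<lambda>_. u" 1 a] that by (simp add: lessThan_Suc)
  show "norm (a 0 0) \<le> op_matrix_norm 1 a"
  proof (rule norm_blinfun_bound)
    show "0 \<le> op_matrix_norm 1 a"
      using unit[of 0] by simp
    fix x
    show "norm (blinfun_apply (a 0 0) x) \<le> op_matrix_norm 1 a * norm x"
      using unit[of "x /\<^sub>R norm x"]
      by (cases "x = 0") (auto simp: blinfun.scaleR_right field_simps)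
  qed
qed

lemma op_matrix_norm_le_seq_matrix_norm:
  "op_matrix_norm n (\<lambda>i j. apply_bcontfun (z i j) k) \<le> seq_matrix_norm n z"
  unfolding seq_matrix_norm_def by (rule cSUP_upper[OF UNIV_I seq_matrix_norm_bdd_above])


section \<open>Completely bounded maps\<close>

lemma seq_matrix_norm_le_cb_norm:
  assumes "cb_norm N seq_matrix_norm E T = ennreal c" and "0 \<le> c" and "1 \<le> n"
    and "\<forall>i<n. \<forall>j<n. a i j \<in> E" and "N n a \<le> 1"
  shows "seq_matrix_norm n (\<lambda>i j. T (a i j)) \<le> c"
proof -
  have "ennreal (seq_matrix_norm n (\<lambda>i j. T (a i j))) \<le> amp_norm N seq_matrix_norm E n T"
    unfolding amp_norm_def by (rule SUP_upper) (use assms in auto)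
  also have "\<dots> \<le> cb_norm N seq_matrix_norm E T"
    unfolding cb_norm_def by (rule SUP_upper) (use assms in auto)
  finally show ?thesis
    using assms by (simp add: ennreal_le_iff)
qed

lemma cb_norm_leI:
  assumes "\<And>n a. 1 \<le> n \<Longrightarrow> \<forall>i<n. \<forall>j<n. a i j \<in> E \<Longrightarrow> N n a \<le> 1 \<Longrightarrow>
    M n (\<lambda>i j. f (a i j)) \<le> c"
  shows "cb_norm N M E f \<le> ennreal c"
  unfolding cb_norm_def amp_norm_def
  by (intro SUP_least ennreal_leI) (use assms in auto)

lemma clinear_on_scaleR:
  assumes "clinear_on E f" and "x \<in> E"
  shows "f (r *\<^sub>R x) = r *\<^sub>R f x"
  using assms unfolding clinear_on_def scaleC_of_real[symmetric] by blast

lemma csubspace_scaleR: "csubspace E \<Longrightarrow> x \<in> E \<Longrightarrow> r *\<^sub>R x \<in> E"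
  unfolding csubspace_def scaleC_of_real[symmetric] by blast

lemma csubspace_diff:
  assumes "csubspace E" and "x \<in> E" and "y \<in> E"
  shows "x - y \<in> E"
proof -
  have "x + (-1) *\<^sub>R y \<in> E"
    using assms csubspace_scaleR[of E y "-1"] unfolding csubspace_def by blast
  then show ?thesis by simp
qed

text \<open>This is the case of \<open>1 \<times> 1\<close> matrices, where the matrix norm is the operator norm.\<close>

lemma cb_norm_bounds_coordinates:
  fixes Y :: "('g::complex_hilbert \<Rightarrow>\<^sub>L 'g) set"
    and T :: "('g \<Rightarrow>\<^sub>L 'g) \<Rightarrow> (nat \<Rightarrow>\<^sub>C ('h::complex_hilbert \<Rightarrow>\<^sub>L 'h))"
  assumes "csubspace Y" and T: "clinear_on Y T"
    and cb: "cb_norm op_matrix_norm seq_matrix_norm Y T = ennreal c" and "0 \<le> c"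
    and y: "y \<in> Y"
  shows "norm (apply_bcontfun (T y) k) \<le> c * norm y"
proof -
  define u where "u = (1 / norm y) *\<^sub>R y"
  have u: "u \<in> Y" "norm u \<le> 1"
    unfolding u_def using assms by (auto intro: csubspace_scaleR)
  have "norm (apply_bcontfun (T u) k) = op_matrix_norm 1 (\<lambda>i j. apply_bcontfun (T u) k)"
    by (simp only: op_matrix_norm_1)
  also have "\<dots> \<le> seq_matrix_norm 1 (\<lambda>i j. T u)"
    by (rule op_matrix_norm_le_seq_matrix_norm)
  also have "\<dots> \<le> c"
    using seq_matrix_norm_le_cb_norm[OF cb \<open>0 \<le> c\<close>, of 1 "\<lambda>_ _. u"] u
    by (simp add: op_matrix_norm_1[simplified])
  finally have *: "norm (apply_bcontfun (T u) k) \<le> c" .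
  have Tu: "T u = (1 / norm y) *\<^sub>R T y"
    unfolding u_def by (rule clinear_on_scaleR[OF T y])
  show ?thesis
  proof (cases "y = 0")
    case True
    have "T (0 *\<^sub>R y) = 0 *\<^sub>R T y"
      by (rule clinear_on_scaleR[OF T y])
    then show ?thesis using True by simp
  next
    case False
    then show ?thesis
      using * by (simp add: Tu field_simps)
  qed
qed


section \<open>Cluster points and diagonal choice\<close>

lemma compactin_infinite_cluster_point:
  assumes K: "compactin X K" and f: "f ` B \<subseteq> K" and B: "infinite B"
  obtains p where "p \<in> K" "\<And>U. openin X U \<Longrightarrow> p \<in> U \<Longrightarrow> infinite {n \<in> B. f n \<in> U}"
proof (rule ccontr)
  assume "\<not> thesis"
  then have "\<forall>p\<in>K. \<exists>U. openin X U \<and> p \<in> U \<and> finite {n \<in> B. f n \<in> U}"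
    using that by blast
  then obtain U where U: "\<And>p. p \<in> K \<Longrightarrow> openin X (U p) \<and> p \<in> U p \<and> finite {n \<in> B. f n \<in> U p}"
    by metis
  then have "\<exists>\<F>. finite \<F> \<and> \<F> \<subseteq> U ` K \<and> K \<subseteq> \<Union>\<F>"
    by (intro compactinD[OF K]) auto
  then obtain F where F: "finite F" "F \<subseteq> K" "K \<subseteq> \<Union>(U ` F)"
    by (metis finite_subset_image)
  have "B \<subseteq> (\<Union>p\<in>F. {n \<in> B. f n \<in> U p})"
    using F f by blast
  moreover have "finite (\<Union>p\<in>F. {n \<in> B. f n \<in> U p})"
    using F U by auto
  ultimately show False
    using B finite_subset by blast
qed

text \<open>At stage \<open>n\<close>, an \<open>s n\<close> is chosen that is good for the largest \<open>m \<le> n\<close> for which this is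
  possible; this \<open>m\<close> tends to infinity with \<open>n\<close>.\<close>

lemma diagonal_selection:
  fixes P :: "nat \<Rightarrow> nat \<Rightarrow> 'a \<Rightarrow> bool"
  assumes ne: "G \<noteq> {}"
    and antimono: "\<And>m m' n S. P m' n S \<Longrightarrow> m \<le> m' \<Longrightarrow> P m n S"
    and ev: "\<And>m. \<forall>\<^sub>F n in sequentially. \<exists>S\<in>G. P m n S"
  obtains s where "\<And>n. s n \<in> G" "\<And>m. \<forall>\<^sub>F n in sequentially. P m n (s n)"
proof -
  define M where "M n = {m. m \<le> n \<and> (\<exists>S\<in>G. P m n S)}" for n
  have fin: "finite (M n)" for n
    unfolding M_def by simp
  have "\<exists>S. S \<in> G \<and> (M n \<noteq> {} \<longrightarrow> P (Max (M n)) n S)" for n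
    using ne Max_in[OF fin, of n] unfolding M_def by blast
  then obtain s where s: "\<And>n. s n \<in> G" "\<And>n. M n \<noteq> {} \<Longrightarrow> P (Max (M n)) n (s n)"
    by metis
  have "\<forall>\<^sub>F n in sequentially. P m n (s n)" for m
    using ev[of m] eventually_ge_at_top[of m]
  proof eventually_elim
    case (elim n)
    then have "m \<in> M n"
      unfolding M_def by simp
    then show ?case
      using s(2)[of n] Max_ge[OF fin] antimono by blast
  qed
  with s(1) show ?thesis by (rule that)
qed

lemma tendsto_zero_on_closure:
  fixes D :: "nat \<Rightarrow> 'a::real_normed_vector \<Rightarrow> 'b::real_normed_vector"
  assumes dense: "\<And>e. 0 < e \<Longrightarrow> \<exists>u\<in>E. norm (y - u) < e"
    and lim: "\<And>u. u \<in> E \<Longrightarrow> (\<lambda>n. D n u) \<longlonglongrightarrow> 0"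
    and lip: "\<And>n u. u \<in> E \<Longrightarrow> norm (D n y - D n u) \<le> C * norm (y - u)"
  shows "(\<lambda>n. D n y) \<longlonglongrightarrow> 0"
proof (rule tendstoI)
  fix e :: real
  assume e: "0 < e"
  \<comment> \<open>A strictly positive Lipschitz constant, to divide by.\<close>
  define C' where "C' = \<bar>C\<bar> + 1"
  have C': "0 < C'" "C \<le> C'"
    unfolding C'_def by auto
  obtain u where u: "u \<in> E" "norm (y - u) < e / 2 / C'"
    using dense[of "e / 2 / C'"] e C' by auto
  have "C * norm (y - u) \<le> C' * norm (y - u)"
    by (intro mult_right_mono C') simp
  also have "\<dots> < e / 2"
    using u C' by (simp add: field_simps)
  finally have small: "norm (D n y - D n u) < e / 2" for n
    using lip[OF u(1), of n] by linarith
  have "\<forall>\<^sub>F n in sequentially. dist (D n u) 0 < e / 2"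
    using lim[OF u(1)] e by (intro tendstoD) auto
  then show "\<forall>\<^sub>F n in sequentially. dist (D n y) 0 < e"
  proof eventually_elim
    case (elim n)
    then show ?case
      using small[of n] norm_triangle_ineq[of "D n y - D n u" "D n u"] by simp
  qed
qed


section \<open>The strong operator topology\<close>

lemma topspace_sot: "topspace (sot E F) = bounded_ops E F"
  unfolding sot_def bounded_ops_def by auto

lemma openin_sot_finite:
  assumes "finite A" and "A \<subseteq> E"
  shows "openin (sot E F) {f \<in> bounded_ops E F. \<forall>y\<in>A. norm (f y - S y) < e}"
  using assms
proof (induction A rule: finite_induct)
  case empty
  show ?case
    using openin_topspace[of "sot E F"] by (simp add: topspace_sot)
next
  case (insert y A)
  have "continuous_map (sot E F) (top_of_set F) (\<lambda>f. f y)"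
    unfolding sot_def using insert.prems
    by (intro continuous_map_from_subtopology continuous_map_product_projection) auto
  moreover have "openin (top_of_set F) (F \<inter> ball (S y) e)"
    by blast
  ultimately have "openin (sot E F) {f \<in> topspace (sot E F). f y \<in> F \<inter> ball (S y) e}"
    by (rule openin_continuous_map_preimage)
  moreover have "{f \<in> topspace (sot E F). f y \<in> F \<inter> ball (S y) e} =
      {f \<in> bounded_ops E F. norm (f y - S y) < e}"
    using insert.prems
    by (auto simp: topspace_sot bounded_ops_def dist_norm norm_minus_commute)
  ultimately have "openin (sot E F) ({f \<in> bounded_ops E F. norm (f y - S y) < e} \<inter>
      {f \<in> bounded_ops E F. \<forall>y\<in>A. norm (f y - S y) < e})"
    using insert by (auto intro: openin_Int)
  then show ?case
    by (rule back_subst[of "openin (sot E F)"]) auto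
qed

text \<open>Only finitely many entries are involved, so closeness of \<open>S\<close> to the maps \<open>f\<close> at finitely many
  points suffices to pass a bound for the matrix norms on to \<open>S\<close>.\<close>

lemma op_matrix_norm_le_if_approx:
  fixes S :: "'a \<Rightarrow> ('h::complex_hilbert \<Rightarrow>\<^sub>L 'h)"
  assumes approx: "\<And>e. 0 < e \<Longrightarrow> \<exists>f. (\<forall>i<n. \<forall>j<n. norm (f (a i j) - S (a i j)) < e) \<and>
      op_matrix_norm n (\<lambda>i j. f (a i j)) \<le> c"
  shows "op_matrix_norm n (\<lambda>i j. S (a i j)) \<le> c"
proof (rule field_le_epsilon)
  fix e :: real
  assume e: "0 < e"
  define d where "d = e / (real n * real n + 1)"
  have pos: "0 < real n * real n + 1"
    using zero_le_square[of "real n"] by linarith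
  have "0 < d"
    unfolding d_def using e pos by simp
  then obtain f where f: "\<And>i j. i < n \<Longrightarrow> j < n \<Longrightarrow> norm (f (a i j) - S (a i j)) < d"
    and c: "op_matrix_norm n (\<lambda>i j. f (a i j)) \<le> c"
    using approx by blast
  have "op_matrix_norm n (\<lambda>i j. f (a i j) - S (a i j)) \<le> (\<Sum>i<n. \<Sum>j<n. d)"
    by (intro order_trans[OF op_matrix_norm_le] sum_mono less_imp_le f) auto
  also have "\<dots> \<le> e"
    unfolding d_def using e pos by (simp add: field_simps)
  finally show "op_matrix_norm n (\<lambda>i j. S (a i j)) \<le> c + e"
    using c op_matrix_norm_triangle_diff[of n "\<lambda>i j. f (a i j)" "\<lambda>i j. f (a i j) - S (a i j)"]
    by simp
qed


section \<open>The extension\<close>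

theorem theorem2p19:
  fixes X Y :: "('g::complex_hilbert \<Rightarrow>\<^sub>L 'g) set"
    and Z :: "('h::complex_hilbert \<Rightarrow>\<^sub>L 'h) set"
    and T :: "('g \<Rightarrow>\<^sub>L 'g) \<Rightarrow> (nat \<Rightarrow>\<^sub>C ('h \<Rightarrow>\<^sub>L 'h))"
  assumes "operator_space Z"
    and "operator_space X" and "operator_space Y" and "X \<subseteq> Y"
    and "separable_space (top_of_set X)" and "separable_space (top_of_set Y)"
    and "completely_bounded op_matrix_norm seq_matrix_norm Y (linfty Z) T"
    and "T ` X \<subseteq> c0 Z"
    and "relatively_compactin (sot Y Z)
           (range (\<lambda>n. restrict (\<lambda>y. apply_bcontfun (T y) n) Y))"
  shows "\<exists>T'. completely_bounded op_matrix_norm seq_matrix_norm Y (c0 Z) T' \<and>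
           (\<forall>x\<in>X. T' x = T x) \<and>
           cb_norm op_matrix_norm seq_matrix_norm Y T' \<le>
             2 * cb_norm op_matrix_norm seq_matrix_norm Y T"
proof -
  define c where "c = enn2real (cb_norm op_matrix_norm seq_matrix_norm Y T)"
  define t where "t n y = apply_bcontfun (T y) n" for n y
  have Y: "csubspace Y" and Z: "csubspace Z"
    using assms(1,3) unfolding operator_space_def by auto
  have TY: "T y \<in> linfty Z" if "y \<in> Y" for y
    using assms(7) that unfolding completely_bounded_def by auto
  have T: "clinear_on Y T" and fin: "cb_norm op_matrix_norm seq_matrix_norm Y T < \<infinity>"
    using assms(7) unfolding completely_bounded_def by auto
  have cb: "cb_norm op_matrix_norm seq_matrix_norm Y T = ennreal c" and c0: "0 \<le> c"
    using fin unfolding c_def by auto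
  have tY: "t n y \<in> Z" if "y \<in> Y" for n y
    using TY[OF that] unfolding linfty_def t_def by auto
  have t_bound: "norm (t n y) \<le> c * norm y" if "y \<in> Y" for n y
    unfolding t_def by (rule cb_norm_bounds_coordinates[OF Y T cb c0 that])
  have t_matrix: "op_matrix_norm n (\<lambda>i j. t k (a i j)) \<le> c"
    if "1 \<le> n" "\<forall>i<n. \<forall>j<n. a i j \<in> Y" "op_matrix_norm n a \<le> 1" for n a k
    unfolding t_def
    using op_matrix_norm_le_seq_matrix_norm[of n "\<lambda>i j. T (a i j)" k]
      seq_matrix_norm_le_cb_norm[of op_matrix_norm Y T c n a, OF cb c0 that]
    by linarith
  have t_lin: "clinear_on Y (t n)" for n
    using T unfolding clinear_on_def t_def by (simp add: apply_bcontfun_scaleC)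
  have t_X: "(\<lambda>n. t n x) \<longlonglongrightarrow> 0" if "x \<in> X" for x
    using assms(8) that unfolding c0_def t_def by (auto simp: tendsto_norm_zero_iff)

  \<comment> \<open>Each of these properties passes from the \<open>t n\<close> to their cluster points, except vanishing
    on \<open>X\<close>, which comes from \<open>t_X\<close>; the norm bound gives the equicontinuity needed to extend
    convergence from a dense subset to \<open>Y\<close>.\<close>
  define G where "G = {S. S ` Y \<subseteq> Z \<and> clinear_on Y S \<and> (\<forall>x\<in>X. S x = 0) \<and>
    (\<forall>y\<in>Y. norm (S y) \<le> c * norm y) \<and>
    (\<forall>n\<ge>1. \<forall>a. (\<forall>i<n. \<forall>j<n. a i j \<in> Y) \<longrightarrow> op_matrix_norm n a \<le> 1 \<longrightarrow>
      op_matrix_norm n (\<lambda>i j. S (a i j)) \<le> c)}"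
  have cluster: "\<exists>S\<in>G. \<forall>A e. finite A \<longrightarrow> A \<subseteq> Y \<longrightarrow> 0 < e \<longrightarrow>
      (\<exists>n\<in>B. \<forall>y\<in>A. norm (t n y - S y) < e)" if B: "infinite B" for B
  proof -
    define R where "R n = restrict (t n) Y" for n
    have rc: "relatively_compactin (sot Y Z) (range R)"
      using assms(9) unfolding R_def t_def .
    then have compact: "compactin (sot Y Z) (sot Y Z closure_of range R)"
      and R: "range R \<subseteq> topspace (sot Y Z)"
      unfolding relatively_compactin_def by auto
    have "R ` B \<subseteq> sot Y Z closure_of range R"
      using closure_of_subset[OF R] by auto
    then obtain S where S: "S \<in> sot Y Z closure_of range R"
      and inf: "\<And>U. openin (sot Y Z) U \<Longrightarrow> S \<in> U \<Longrightarrow> infinite {n \<in> B. R n \<in> U}"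
      using compactin_infinite_cluster_point[OF compact _ B] by blast
    have SB: "S \<in> bounded_ops Y Z"
      using S closure_of_subset_topspace by (force simp: topspace_sot)
    \<comment> \<open>Closeness for infinitely many \<open>n\<close>, as \<open>t n x\<close> is small only for large \<open>n\<close>.\<close>
    have close: "infinite {n \<in> B. \<forall>y\<in>A. norm (t n y - S y) < e}"
      if A: "finite A" "A \<subseteq> Y" and e: "0 < e" for A e
    proof -
      have "infinite {n \<in> B. R n \<in> {f \<in> bounded_ops Y Z. \<forall>y\<in>A. norm (f y - S y) < e}}"
        using SB e by (intro inf openin_sot_finite A) auto
      moreover have "{n \<in> B. R n \<in> {f \<in> bounded_ops Y Z. \<forall>y\<in>A. norm (f y - S y) < e}} \<subseteq>
          {n \<in> B. \<forall>y\<in>A. norm (t n y - S y) < e}"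
        using A by (auto simp: R_def subset_iff)
      ultimately show ?thesis
        using infinite_super by blast
    qed
    have close_ex: "\<exists>n\<in>B. \<forall>y\<in>A. norm (t n y - S y) < e"
      if A: "finite A" "A \<subseteq> Y" and e: "0 < e" for A e
      using infinite_imp_nonempty[OF close[OF A e]] by blast
    have "S x = 0" if x: "x \<in> X" for x
    proof -
      have "norm (S x) \<le> 0 + e" if e: "0 < e" for e
      proof -
        have "\<forall>\<^sub>F n in sequentially. norm (t n x) < e / 2"
          using tendstoD[OF t_X[OF x], of "e / 2"] e by simp
        then obtain N where N: "\<And>n. n \<ge> N \<Longrightarrow> norm (t n x) < e / 2"
          unfolding eventually_sequentially by blast
        obtain n where n: "n \<ge> N" "norm (t n x - S x) < e / 2"
          using close[of "{x}" "e / 2"] x e assms(4)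
          by (auto simp: infinite_nat_iff_unbounded_le)
        show ?thesis
          using N[OF n(1)] n(2) norm_triangle_sub[of "S x" "t n x"] 
          by (simp add: norm_minus_commute)
      qed
      then have "norm (S x) \<le> 0"
        by (rule field_le_epsilon)
      then show ?thesis by simp
    qed
    moreover have "norm (S y) \<le> c * norm y" if y: "y \<in> Y" for y
    proof (rule field_le_epsilon)
      fix e :: real
      assume "0 < e"
      then obtain n where "norm (t n y - S y) < e"
        using close_ex[of "{y}" e] y by auto
      then show "norm (S y) \<le> c * norm y + e"
        using t_bound[OF y, of n] norm_triangle_sub[of "S y" "t n y"]
        by (simp add: norm_minus_commute)
    qed
    moreover have "op_matrix_norm n (\<lambda>i j. S (a i j)) \<le> c"
      if a: "1 \<le> n" "\<forall>i<n. \<forall>j<n. a i j \<in> Y" "op_matrix_norm n a \<le> 1" for n a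
    proof (rule op_matrix_norm_le_if_approx[where S = S and a = a])
      fix e :: real
      assume e: "0 < e"
      have "(\<lambda>(i, j). a i j) ` ({..<n} \<times> {..<n}) \<subseteq> Y"
        using a(2) by auto
      then obtain k
        where k: "\<forall>y\<in>(\<lambda>(i, j). a i j) ` ({..<n} \<times> {..<n}). norm (t k y - S y) < e"
        using close_ex[of "(\<lambda>(i, j). a i j) ` ({..<n} \<times> {..<n})" e] e by blast
      show "\<exists>f. (\<forall>i<n. \<forall>j<n. norm (f (a i j) - S (a i j)) < e) \<and>
          op_matrix_norm n (\<lambda>i j. f (a i j)) \<le> c"
        by (intro exI[of _ "t k"]) (use k t_matrix[OF a] in auto)
    qed
    ultimately have "S \<in> G"
      using SB unfolding G_def bounded_ops_def by auto
    with close_ex show ?thesis by blast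
  qed
  then have "G \<noteq> {}"
    using infinite_UNIV_nat by blast

  obtain D where D: "countable D" "D \<subseteq> Y" "top_of_set Y closure_of D = Y"
    using assms(6) unfolding separable_space_def by auto
  have dense: "\<exists>u\<in>D. norm (y - u) < e" if "y \<in> Y" "0 < e" for y e
  proof -
    have "y \<in> top_of_set Y closure_of D"
      using D that by simp
    moreover have "openin (top_of_set Y) (Y \<inter> ball y e)" "y \<in> Y \<inter> ball y e"
      using that by auto
    ultimately obtain u where "u \<in> D" "u \<in> Y \<inter> ball y e"
      unfolding in_closure_of by blast
    then show ?thesis by (auto simp: dist_norm)
  qed
  have "D \<noteq> {}"
    using dense[of 0 1] Y unfolding csubspace_def by auto
  define d where "d = from_nat_into D"
  have d: "range d = D"
    unfolding d_def using D(1) \<open>D \<noteq> {}\<close> by simp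

  \<comment> \<open>More points and a smaller error as \<open>m\<close> grows, so that \<open>P m n S\<close> is antitone in \<open>m\<close>.\<close>
  define P where "P m n S \<longleftrightarrow> (\<forall>k<m. norm (t n (d k) - S (d k)) < inverse (real (Suc m)))"
    for m n S
  obtain s where sG: "\<And>n. s n \<in> G" and sP: "\<And>m. \<forall>\<^sub>F n in sequentially. P m n (s n)"
  proof (rule diagonal_selection[of G P])
    show "G \<noteq> {}" by fact
    show "P m n S" if "P m' n S" "m \<le> m'" for m m' n S
    proof -
      have "inverse (real (Suc m')) \<le> inverse (real (Suc m))"
        using that by (intro le_imp_inverse_le) auto
      then show ?thesis
        using that unfolding P_def by (blast intro: less_le_trans)
    qed
    show "\<forall>\<^sub>F n in sequentially. \<exists>S\<in>G. P m n S" for m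
    proof (rule ccontr)
      \<comment> \<open>The indices without a good \<open>S\<close> have a cluster point of their own, which is good for one
        of them.\<close>
      define B where "B = {n. \<not> (\<exists>S\<in>G. P m n S)}"
      assume "\<not> ?thesis"
      then have "infinite B"
        unfolding B_def by (simp add: cofinite_eq_sequentially[symmetric] eventually_cofinite)
      then obtain S where S: "S \<in> G" "\<And>A e. finite A \<Longrightarrow> A \<subseteq> Y \<Longrightarrow> 0 < e \<Longrightarrow>
          (\<exists>n\<in>B. \<forall>y\<in>A. norm (t n y - S y) < e)"
        using cluster[of B] by blast
      have "\<exists>n\<in>B. \<forall>y\<in>d ` {..<m}. norm (t n y - S y) < inverse (real (Suc m))"
        using d D(2) by (intro S(2)) auto
      then show False
        using S(1) unfolding B_def P_def by auto
    qed
  qed (rule that)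
  have sZ: "s n y \<in> Z" and s_bound: "norm (s n y) \<le> c * norm y" if "y \<in> Y" for n y
    using sG[of n] that unfolding G_def by auto
  have s_lin: "clinear_on Y (s n)" and s_X: "x \<in> X \<Longrightarrow> s n x = 0" for n x
    using sG[of n] unfolding G_def by auto
  have s_matrix: "op_matrix_norm n (\<lambda>i j. s k (a i j)) \<le> c"
    if "1 \<le> n" "\<forall>i<n. \<forall>j<n. a i j \<in> Y" "op_matrix_norm n a \<le> 1" for n a k
    using sG[of k] that unfolding G_def by blast

  define r where "r n y = t n y - s n y" for n y
  have rZ: "r n y \<in> Z" if "y \<in> Y" for n y
    unfolding r_def by (intro csubspace_diff Z tY sZ that)
  have r_lin: "clinear_on Y (r n)" for n
    using t_lin[of n] s_lin[of n]
    unfolding clinear_on_def r_def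
    by (simp add: linear_diff[OF bounded_linear.linear[OF bounded_linear_scaleC]])
  have r_bound: "norm (r n y) \<le> 2 * c * norm y" if "y \<in> Y" for n y
    using norm_triangle_ineq4[of "t n y" "s n y"] t_bound[OF that, of n] s_bound[OF that, of n]
    unfolding r_def by simp
  have r_diff: "r n (x - y) = r n x - r n y" if "x \<in> Y" "y \<in> Y" for n x y
  proof -
    have "r n (x - y + y) = r n (x - y) + r n y"
      using r_lin[of n] that csubspace_diff[OF Y that] unfolding clinear_on_def by blast
    then show ?thesis by simp
  qed
  have r_D: "(\<lambda>n. r n u) \<longlonglongrightarrow> 0" if "u \<in> D" for u
  proof (rule tendstoI)
    fix e :: real
    assume "0 < e"
    obtain k where k: "u = d k"
      using \<open>u \<in> D\<close> unfolding d[symmetric] by blast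
    obtain m0 where m0: "inverse (real (Suc m0)) < e"
      using reals_Archimedean[OF \<open>0 < e\<close>] by blast
    define m where "m = max m0 (Suc k)"
    have "inverse (real (Suc m)) \<le> inverse (real (Suc m0))"
      unfolding m_def by (intro le_imp_inverse_le) auto
    then have inv_m: "inverse (real (Suc m)) < e"
      using m0 by (rule le_less_trans)
    have "k < m"
      unfolding m_def by simp
    show "\<forall>\<^sub>F n in sequentially. dist (r n u) 0 < e"
      using sP[of m]
    proof eventually_elim
      case (elim n)
      then have "norm (r n u) < inverse (real (Suc m))"
        using \<open>k < m\<close> unfolding P_def r_def k by blast
      then show ?case
        using inv_m by simp
    qed
  qed
  have r_lim: "(\<lambda>n. r n y) \<longlonglongrightarrow> 0" if y: "y \<in> Y" for y
  proof (rule tendsto_zero_on_closure[OF dense[OF y] r_D])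
    fix n u
    assume "u \<in> D"
    then have "u \<in> Y" using D by auto
    then show "norm (r n y - r n u) \<le> 2 * c * norm (y - u)"
      using r_bound[OF csubspace_diff[OF Y y]] y by (simp add: r_diff[symmetric])
  qed

  define T' where "T' y = Bcontfun (\<lambda>n. r n y)" for y
  have T': "apply_bcontfun (T' y) n = r n y" if "y \<in> Y" for n y
  proof -
    have "(\<lambda>n. r n y) \<in> bcontfun"
      using r_bound[OF that] by (intro bcontfun_normI) auto
    then show ?thesis unfolding T'_def by (simp add: Bcontfun_inverse)
  qed
  have T'_lin: "clinear_on Y T'"
    using r_lin Y unfolding clinear_on_def csubspace_def
    by (auto intro!: bcontfun_eqI simp: T' apply_bcontfun_scaleC)
  have T'_c0: "T' ` Y \<subseteq> c0 Z"
    using r_lim rZ unfolding c0_def linfty_def by (auto simp: T' tendsto_norm_zero_iff)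
  have T'_X: "T' x = T x" if "x \<in> X" for x
    using that assms(4) s_X by (intro bcontfun_eqI) (auto simp: T' r_def t_def)
  have cb_T': "cb_norm op_matrix_norm seq_matrix_norm Y T' \<le> ennreal (2 * c)"
  proof (rule cb_norm_leI)
    fix n :: nat and a :: "nat \<Rightarrow> nat \<Rightarrow> ('g \<Rightarrow>\<^sub>L 'g)"
    assume a: "1 \<le> n" "\<forall>i<n. \<forall>j<n. a i j \<in> Y" "op_matrix_norm n a \<le> 1"
    show "seq_matrix_norm n (\<lambda>i j. T' (a i j)) \<le> 2 * c"
      unfolding seq_matrix_norm_def
    proof (rule cSUP_least)
      fix k
      have "op_matrix_norm n (\<lambda>i j. apply_bcontfun (T' (a i j)) k) =
          op_matrix_norm n (\<lambda>i j. t k (a i j) - s k (a i j))"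
        unfolding op_matrix_norm_def L2_set_def using a(2) by (simp add: T' r_def)
      also have "\<dots> \<le> op_matrix_norm n (\<lambda>i j. t k (a i j)) + op_matrix_norm n (\<lambda>i j. s k (a i j))"
        by (rule op_matrix_norm_triangle_diff)
      also have "\<dots> \<le> 2 * c"
        using t_matrix[OF a, of k] s_matrix[OF a, of k] by simp
      finally show "op_matrix_norm n (\<lambda>i j. apply_bcontfun (T' (a i j)) k) \<le> 2 * c" .
    qed simp
  qed
  then have "cb_norm op_matrix_norm seq_matrix_norm Y T' < \<infinity>"
    using le_less_trans[OF _ ennreal_less_top] by simp
  then have "completely_bounded op_matrix_norm seq_matrix_norm Y (c0 Z) T'"
    using T'_lin T'_c0 unfolding completely_bounded_def by blast
  moreover have "cb_norm op_matrix_norm seq_matrix_norm Y T' \<le>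
      2 * cb_norm op_matrix_norm seq_matrix_norm Y T"
    using cb_T' c0 by (simp add: cb ennreal_mult)
  ultimately show ?thesis using T'_X by blast
qed

end
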